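(* Let $r$ be a nonnegative integer, $n$ a positive integer, and $\varepsilon\in\{1,-1\}$. Then $$\sum_{k=0}^{n-1}\varepsilon^k (2k+1)k^r(k+1)^r D_k \equiv 0 \pmod n,$$ $$\sum_{k=0}^{n-1}\varepsilon^k (2k+1)^{2r+1}D_k \equiv 0 \pmod n,$$ where $D_k$ denotes the $k$-th central Delannoy number.
   Context: The central Delannoy numbers are defined, for each nonnegative integer $n$, by $D_n=\sum_{k=0}^{n}\binom{n+k}{2k}\binom{2k}{k}$. The convention $0^0=1$ is used (so $k^r=1$ when $r=0$). *)

theory Defs
  imports "HOL-Number_Theory.Cong"
begin

definition central_delannoy :: "nat \<Rightarrow> nat" where
  "central_delannoy n = (\<Sum>k=0..n. ((n + k) choose (2 * k)) * ((2 * k) choose k))"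

end

theory Submission
  imports Defs
begin

text \<open>
  Put \<open>P\<^sub>j(k) = binom(k, j) binom(k+j, j)\<close>, so that \<open>D\<^sub>k\<close> is the sum of all \<open>P\<^sub>j(k)\<close>. Since
  \<open>k(k+1) P\<^sub>j(k) = (j+1)\<^sup>2 P\<^sub>j\<^sub>+\<^sub>1(k) + j(j+1) P\<^sub>j(k)\<close>, the factor \<open>(k(k+1))\<^sup>r\<close> can be removed one power
  at a time with \<open>j\<close> left arbitrary. For \<open>r = 0\<close> the sum of \<open>\<epsilon>\<^sup>k (2k+1) P\<^sub>j(k)\<close> over \<open>k < n\<close>
  telescopes to \<open>n binom(n, j+1) binom(n+j, j)\<close> if \<open>\<epsilon> = 1\<close>, and to \<open>\<plusminus> n binom(n-1, j) binom(n+j, j)\<close>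
  if \<open>\<epsilon> = -1\<close>. The second congruence follows from the first because \<open>(2k+1)\<^sup>2 = 4k(k+1) + 1\<close>.
\<close>

definition delannoy_term :: "nat \<Rightarrow> nat \<Rightarrow> int" where
  "delannoy_term j k = int (k choose j) * int ((k + j) choose j)"

text \<open>Working in \<open>int\<close> makes \<open>int n - int j\<close> a true difference, so
  the absorption identity holds for all \<open>j\<close>: when \<open>j > n\<close>, both binomials
  vanish.\<close>

lemma int_Suc_times_choose_Suc:
  "(int j + 1) * int (n choose Suc j) = (int n - int j) * int (n choose j)"
proof (cases "j \<le> n")
  case True
  have "Suc j * (n choose Suc j) = (n - j) * (n choose j)"
    using binomial_absorb_comp[of n j] binomial_absorption[of j n] by simp
  hence "int (Suc j * (n choose Suc j)) = int ((n - j) * (n choose j))"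
    by (rule arg_cong)
  thus ?thesis
    using True by (simp add: of_nat_diff algebra_simps)
qed (simp add: binomial_eq_0)

lemma int_diff_times_Suc_choose:
  "(int n + 1 - int j) * int (Suc n choose j) = (int n + 1) * int (n choose j)"
proof (cases "j \<le> Suc n")
  case True
  have "(Suc n - j) * (Suc n choose j) = Suc n * (n choose j)"
    using binomial_absorb_comp[of "Suc n" j] by simp
  hence "int (Suc n - j) * int (Suc n choose j) = int (Suc n) * int (n choose j)"
    by (simp only: flip: of_nat_mult)
  thus ?thesis
    using True by (simp add: of_nat_diff add.commute)
qed (simp add: binomial_eq_0)

lemma int_Suc_times_Suc_choose_Suc:
  "(int j + 1) * int (Suc n choose Suc j) = (int n + 1) * int (n choose j)"
proof -
  have "int (Suc j * (Suc n choose Suc j)) = int (Suc n * (n choose j))"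
    using Suc_times_binomial_eq[of n j] by (metis mult.commute)
  thus ?thesis
    by (simp del: binomial_Suc_Suc add: algebra_simps)
qed

text \<open>Absorption in both binomials turns \<open>delannoy_term j k\<close> into
  \<open>delannoy_term (Suc j) k\<close> at the cost of the factor (k - j)(k + j + 1), which equals
  k(k+1) - j(j+1).\<close>

lemma delannoy_term_recurrence:
  "int k * (int k + 1) * delannoy_term j k
     = (int j + 1)\<^sup>2 * delannoy_term (Suc j) k + int j * (int j + 1) * delannoy_term j k"
proof -
  have "(int j + 1)\<^sup>2 * delannoy_term (Suc j) k
      = ((int j + 1) * int (k choose Suc j)) * ((int j + 1) * int (Suc (k + j) choose Suc j))"
    by (simp del: binomial_Suc_Suc add: delannoy_term_def power2_eq_square)
  also have "\<dots> = (int k - int j) * (int k + int j + 1) * delannoy_term j k"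
    by (simp only: int_Suc_times_choose_Suc[of j k] int_Suc_times_Suc_choose_Suc)
       (simp add: delannoy_term_def algebra_simps)
  finally show ?thesis
    by (simp add: algebra_simps)
qed

text \<open>Terms with \<open>j > k\<close> vanish, so one range \<open>j < n\<close> serves every
  \<open>k < n\<close>; this lets the sums over \<open>j\<close> and \<open>k\<close> be swapped
  later.\<close>

lemma central_delannoy_eq_sum_delannoy_term:
  assumes "k < n"
  shows "int (central_delannoy k) = (\<Sum>j<n. delannoy_term j k)"
proof -
  have "((k + j) choose (2 * j)) * ((2 * j) choose j) = (k choose j) * ((k + j) choose j)"
    if "j \<le> k" for j
    using choose_mult[of j "2 * j" "k + j"] that by (simp add: mult_2)
  hence "int (central_delannoy k) = (\<Sum>j=0..k. delannoy_term j k)"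
    by (simp add: central_delannoy_def delannoy_term_def flip: of_nat_mult)
  also have "\<dots> = (\<Sum>j<n. delannoy_term j k)"
    using assms by (intro sum.mono_neutral_left) (auto simp: delannoy_term_def)
  finally show ?thesis .
qed

lemma sum_delannoy_term:
  "(\<Sum>k<n. (2 * int k + 1) * delannoy_term j k)
     = int n * int (n choose Suc j) * int ((n + j) choose j)"
proof (induction n)
  case (Suc n)
  define a where "a = int (n choose j)"
  define b where "b = int ((n + j) choose j)"
  define b' where "b' = int ((Suc n + j) choose j)"
  have b': "(int n + 1) * b' = (int n + int j + 1) * b"
    using int_diff_times_Suc_choose[of "n + j" j] by (simp add: b_def b'_def)
  \<comment> \<open>The factor j + 1 lets every binomial be expressed through \<open>a\<close> and
    \<open>b\<close>. What remains is n(n - j) + (j + 1)(2n + 1) = (n + 1)(n + j + 1); the factor,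
    being nonzero, is cancelled at the end.\<close>
  have "(int j + 1) * (int n * int (n choose Suc j) * b + (2 * int n + 1) * (a * b))
      = int n * b * ((int j + 1) * int (n choose Suc j)) + (int j + 1) * (2 * int n + 1) * (a * b)"
    by (simp add: algebra_simps)
  also have "\<dots> = (int n + 1) * a * ((int n + int j + 1) * b)"
    by (simp add: int_Suc_times_choose_Suc flip: a_def) (simp add: algebra_simps)
  also have "\<dots> = (int n + 1) * ((int j + 1) * int (Suc n choose Suc j)) * b'"
    by (simp only: int_Suc_times_Suc_choose_Suc a_def[symmetric] b'[symmetric]) simp
  finally have "(int j + 1) * (int n * int (n choose Suc j) * b + (2 * int n + 1) * (a * b))
      = (int j + 1) * ((int n + 1) * int (Suc n choose Suc j) * b')"
    by (simp del: binomial_Suc_Suc add: algebra_simps)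
  hence "int n * int (n choose Suc j) * b + (2 * int n + 1) * (a * b)
      = (int n + 1) * int (Suc n choose Suc j) * b'"
    by (subst (asm) mult_cancel_left) linarith
  thus ?case
    using Suc.IH by (simp del: binomial_Suc_Suc add: delannoy_term_def a_def b_def b'_def add.commute)
qed simp

text \<open>Telescoping works because (n + 1 - j) P_j(n+1) = (n + j + 1) P_j(n), where P_j is
  \<open>delannoy_term j\<close>, and n + j + 1 = (2n + 1) - (n - j).\<close>

lemma alternating_sum_delannoy_term:
  "(\<Sum>k<n. (-1) ^ k * (2 * int k + 1) * delannoy_term j k)
     = - ((-1) ^ n * (int n - int j) * delannoy_term j n)"
proof (induction n)
  case 0
  show ?case by (cases j) (simp_all add: delannoy_term_def)
next
  case (Suc n)
  have "(int (Suc n) - int j) * delannoy_term j (Suc n)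
      = ((int n + 1 - int j) * int (Suc n choose j)) * int (Suc (n + j) choose j)"
    by (simp add: delannoy_term_def algebra_simps)
  also have "\<dots> = int (n choose j) * ((int (n + j) + 1 - int j) * int (Suc (n + j) choose j))"
    by (simp add: int_diff_times_Suc_choose)
  also have "\<dots> = (int n + int j + 1) * delannoy_term j n"
    by (simp only: int_diff_times_Suc_choose) (simp add: delannoy_term_def)
  finally have "(int (Suc n) - int j) * delannoy_term j (Suc n)
      = (int n + int j + 1) * delannoy_term j n" .
  hence "- ((-1) ^ Suc n * (int (Suc n) - int j) * delannoy_term j (Suc n))
      = (-1) ^ n * ((int n + int j + 1) * delannoy_term j n)"
    by (simp add: mult.assoc del: of_nat_Suc)
  thus ?case
    using Suc.IH by (simp add: algebra_simps)
qed

text \<open>For positive \<open>n\<close>, absorption gives (n - j) binom(n, j) = n binom(n-1, j),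
  which exposes the factor \<open>n\<close> in the alternating sum.\<close>

lemma dvd_diff_times_delannoy_term: "int n dvd (int n - int j) * delannoy_term j n"
proof (cases n)
  case 0
  thus ?thesis by (cases j) (simp_all add: delannoy_term_def)
next
  case (Suc m)
  have "(int n - int j) * delannoy_term j n
      = ((int m + 1 - int j) * int (Suc m choose j)) * int ((n + j) choose j)"
    by (simp add: delannoy_term_def Suc algebra_simps)
  also have "\<dots> = int n * (int (m choose j) * int ((n + j) choose j))"
    by (simp add: int_diff_times_Suc_choose Suc)
  finally show ?thesis by simp
qed

lemma dvd_sum_delannoy_term:
  assumes "\<epsilon> \<in> {1, -1 :: int}"
  shows "int n dvd (\<Sum>k<n. \<epsilon> ^ k * (2 * int k + 1) * (int k * (int k + 1)) ^ r * delannoy_term j k)"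
proof (induction r arbitrary: j)
  case 0
  from assms consider "\<epsilon> = 1" | "\<epsilon> = -1" by blast
  thus ?case
  proof cases
    case 1
    thus ?thesis by (simp add: sum_delannoy_term)
  next
    case 2
    thus ?thesis
      using dvd_diff_times_delannoy_term[of n j]
      by (simp add: alternating_sum_delannoy_term) (simp add: mult.assoc)
  qed
next
  case (Suc r)
  let ?S = "\<lambda>j. \<Sum>k<n. \<epsilon> ^ k * (2 * int k + 1) * (int k * (int k + 1)) ^ r * delannoy_term j k"
  have "(\<Sum>k<n. \<epsilon> ^ k * (2 * int k + 1) * (int k * (int k + 1)) ^ Suc r * delannoy_term j k)
      = (\<Sum>k<n. \<epsilon> ^ k * (2 * int k + 1) * (int k * (int k + 1)) ^ r
               * (int k * (int k + 1) * delannoy_term j k))"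
    by (simp add: mult_ac)
  \<comment> \<open>Both coefficients of the recurrence are free of \<open>k\<close>, so they leave
    the sum, and the induction hypothesis applies at \<open>Suc j\<close> and at
    \<open>j\<close>.\<close>
  also have "\<dots> = (int j + 1)\<^sup>2 * ?S (Suc j) + int j * (int j + 1) * ?S j"
    unfolding sum_distrib_left sum.distrib[symmetric]
    by (intro sum.cong refl, subst delannoy_term_recurrence) (simp add: algebra_simps)
  finally show ?case
    using Suc.IH[of "Suc j"] Suc.IH[of j] by simp
qed

lemma dvd_sum_central_delannoy:
  assumes "\<epsilon> \<in> {1, -1 :: int}"
  shows "int n dvd (\<Sum>k<n. \<epsilon> ^ k * (2 * int k + 1) * (int k * (int k + 1)) ^ r
                          * int (central_delannoy k))"
proof -
  have "(\<Sum>k<n. \<epsilon> ^ k * (2 * int k + 1) * (int k * (int k + 1)) ^ r * int (central_delannoy k))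
      = (\<Sum>k<n. \<Sum>j<n. \<epsilon> ^ k * (2 * int k + 1) * (int k * (int k + 1)) ^ r * delannoy_term j k)"
    by (intro sum.cong)
       (simp_all add: central_delannoy_eq_sum_delannoy_term[of _ n] sum_distrib_left)
  also have "\<dots> = (\<Sum>j<n. \<Sum>k<n. \<epsilon> ^ k * (2 * int k + 1) * (int k * (int k + 1)) ^ r
                                * delannoy_term j k)"
    by (rule sum.swap)
  finally show ?thesis
    by (simp add: dvd_sum dvd_sum_delannoy_term[OF assms])
qed

text \<open>Expanding (4k(k+1) + 1)^r by the binomial theorem makes this sum an integer combination
  of the sums in \<open>dvd_sum_central_delannoy\<close> with exponents
  \<open>i \<le> r\<close>.\<close>

lemma dvd_sum_odd_power_central_delannoy:
  assumes "\<epsilon> \<in> {1, -1 :: int}"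
  shows "int n dvd (\<Sum>k<n. \<epsilon> ^ k * (2 * int k + 1) ^ (2 * r + 1) * int (central_delannoy k))"
proof -
  have expand: "(2 * int k + 1) ^ (2 * r + 1)
      = (\<Sum>i\<le>r. int (r choose i) * 4 ^ i * ((2 * int k + 1) * (int k * (int k + 1)) ^ i))" for k
  proof -
    have "(2 * int k + 1) ^ (2 * r + 1) = (2 * int k + 1) * ((2 * int k + 1)\<^sup>2) ^ r"
      by (simp add: power_mult)
    also have "(2 * int k + 1)\<^sup>2 = 4 * (int k * (int k + 1)) + 1"
      by (simp add: power2_eq_square algebra_simps)
    also have "(4 * (int k * (int k + 1)) + 1) ^ r
        = (\<Sum>i\<le>r. int (r choose i) * (4 ^ i * (int k * (int k + 1)) ^ i))"
      unfolding binomial_ring[of _ 1 r] power_mult_distrib[of 4] by simp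
    finally show ?thesis
      by (simp add: sum_distrib_left mult_ac)
  qed
  have "(\<Sum>k<n. \<epsilon> ^ k * (2 * int k + 1) ^ (2 * r + 1) * int (central_delannoy k))
      = (\<Sum>k<n. \<Sum>i\<le>r. int (r choose i) * 4 ^ i
          * (\<epsilon> ^ k * (2 * int k + 1) * (int k * (int k + 1)) ^ i * int (central_delannoy k)))"
    unfolding expand by (simp add: sum_distrib_left sum_distrib_right mult_ac)
  also have "\<dots> = (\<Sum>i\<le>r. int (r choose i) * 4 ^ i
      * (\<Sum>k<n. \<epsilon> ^ k * (2 * int k + 1) * (int k * (int k + 1)) ^ i * int (central_delannoy k)))"
    by (subst sum.swap) (simp add: sum_distrib_left)
  finally show ?thesis
    by (simp only:) (intro dvd_sum dvd_mult dvd_sum_central_delannoy[OF assms])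
qed

theorem theorem1p2:
  fixes r n :: nat and \<epsilon> :: int
  assumes "n > 0" and "\<epsilon> \<in> {1, -1}"
  shows "[(\<Sum>k=0..n-1. \<epsilon> ^ k * (2 * int k + 1) * int k ^ r * (int k + 1) ^ r
            * int (central_delannoy k)) = 0] (mod int n)
       \<and> [(\<Sum>k=0..n-1. \<epsilon> ^ k * (2 * int k + 1) ^ (2 * r + 1)
            * int (central_delannoy k)) = 0] (mod int n)"
proof -
  \<comment> \<open>Positivity of \<open>n\<close> matters here: subtraction on \<open>nat\<close>
    truncates, so at \<open>n = 0\<close> the left side would be {0}.\<close>
  have "{0..n-1} = {..<n}"
    using assms(1) by auto
  thus ?thesis
    using dvd_sum_central_delannoy[OF assms(2), of n r]
      dvd_sum_odd_power_central_delannoy[OF assms(2), of n r]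
    by (simp only: cong_0_iff power_mult_distrib mult.assoc)
qed

end
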